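(* (1) Let $\Gamma\cup\{A\}$ be a set of formulas without classical variables. Then $\Gamma\vdash_{pml}A$ if and only if $\Gamma\vdash_{(i)}A$. (2) Let $\Gamma\cup\{A\}$ be a set of formulas without classical variables and without intuitionistic variables. Then $\Gamma\vdash_{pml}A$ if and only if $\Gamma\vdash_{(m)}A$.
   Context: Formulas. Let $\mathcal V_m$ (minimal variables), $\mathcal V_i$ (intuitionistic variables), $\mathcal V_c$ (classical variables) be three disjoint countable sets of propositional variables and $\perp$ a special constant; put $\mathcal P=\mathcal V_m\cup\mathcal V_i\cup\mathcal V_c\cup\{\perp\}$. Formulas are built inductively from elements of $\mathcal P$ using $\wedge,\vee,\to$; $\neg A$ abbreviates $A\to\perp$. $var(A)$ is the set of variables of $A$ (so $\perp$ is not counted). $A$ is a classical formula if $var(A)\subseteq\mathcal V_c$, and an intuitionistic formula if $var(A)\subseteq\mathcal V_i\cup\mathcal V_c$. The system PML. A simple sequent is $\Gamma\vdash A$ with $\Gamma\cup\{A\}$ a finite set of formulas; commas denote union. Rules ($j\in\{1,2\}$): (Ax) $A\vdash A$; (W) from $\Gamma\vdash A$ infer $\Gamma,B\vdash A$; ($\wedge_I$) from $\Gamma_1\vdash A_1$ and $\Gamma_2\vdash A_2$ infer $\Gamma_1,\Gamma_2\vdash A_1\wedge A_2$; ($\wedge_E$) from $\Gamma\vdash A_1\wedge A_2$ infer $\Gamma\vdash A_j$; ($\vee_I$) from $\Gamma\vdash A_j$ infer $\Gamma\vdash A_1\vee A_2$; ($\vee_E$) from $\Gamma_1\vdash A_1\vee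 A_2$, $\Gamma_2,A_1\vdash B$ and $\Gamma_3,A_2\vdash B$ infer $\Gamma_1,\Gamma_2,\Gamma_3\vdash B$; ($\to_I$) from $\Gamma,A_1\vdash A_2$ infer $\Gamma\vdash A_1\to A_2$; ($\to_E$) from $\Gamma_1\vdash A_1\to A_2$ and $\Gamma_2\vdash A_1$ infer $\Gamma_1,\Gamma_2\vdash A_2$; ($\perp_i$) from $\Gamma\vdash\perp$ infer $\Gamma\vdash A$, provided $A$ is an intuitionistic formula; ($\perp_c$) from $\Gamma\vdash\neg\neg A$ infer $\Gamma\vdash A$, provided $A$ is a classical formula. $\Gamma\vdash_{pml}A$ means that $\Gamma\vdash A$ is derivable with these rules. $\Gamma\vdash_{(i)}A$ means that it is derivable without using the rule $(\perp_c)$. $\Gamma\vdash_{(m)}A$ means that it is derivable without using the rules $(\perp_i)$ and $(\perp_c)$. For infinite $\Gamma$, each of these means that the corresponding relation holds for some finite subset of $\Gamma$. *)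

theory Defs
  imports "HOL-Library.Countable"
begin

datatype ('m, 'i, 'c) pvar = MVar 'm | IVar 'i | CVar 'c

abbreviation intuitionistic_vars :: "('m, 'i, 'c) pvar set" where
  "intuitionistic_vars \<equiv> range IVar"

abbreviation classical_vars :: "('m, 'i, 'c) pvar set" where
  "classical_vars \<equiv> range CVar"

datatype (vars: 'v) form =
    Var 'v
  | Bot  (\<open>\<^bold>\<bottom>\<close>)
  | Conj "'v form" "'v form"  (infixr \<open>\<^bold>\<and>\<close> 65)
  | Disj "'v form" "'v form"  (infixr \<open>\<^bold>\<or>\<close> 60)
  | Imp "'v form" "'v form"  (infixr \<open>\<^bold>\<rightarrow>\<close> 55)

abbreviation Neg :: "'v form \<Rightarrow> 'v form"  (\<open>\<^bold>\<not> _\<close> [70] 70) where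
  "\<^bold>\<not> A \<equiv> A \<^bold>\<rightarrow> \<^bold>\<bottom>"

type_synonym ('m, 'i, 'c) formula = "('m, 'i, 'c) pvar form"

definition classical :: "('m, 'i, 'c) formula \<Rightarrow> bool" where
  "classical A \<longleftrightarrow> vars A \<subseteq> classical_vars"

definition intuitionistic :: "('m, 'i, 'c) formula \<Rightarrow> bool" where
  "intuitionistic A \<longleftrightarrow> vars A \<subseteq> intuitionistic_vars \<union> classical_vars"

datatype bot_rule = BotI | BotC

text \<open>The parameter \<open>R\<close> is the set of absurdity rules that derivations may use; all other
  rules are always available.\<close>

inductive derivable ::
  "bot_rule set \<Rightarrow> ('m, 'i, 'c) formula set \<Rightarrow> ('m, 'i, 'c) formula \<Rightarrow> bool"
  for R :: "bot_rule set"
where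
  Ax: "derivable R {A} A"
| W: "derivable R \<Gamma> A \<Longrightarrow> derivable R (\<Gamma> \<union> {B}) A"
| ConjI: "derivable R \<Gamma>1 A1 \<Longrightarrow> derivable R \<Gamma>2 A2 \<Longrightarrow>
    derivable R (\<Gamma>1 \<union> \<Gamma>2) (A1 \<^bold>\<and> A2)"
| ConjE1: "derivable R \<Gamma> (A1 \<^bold>\<and> A2) \<Longrightarrow> derivable R \<Gamma> A1"
| ConjE2: "derivable R \<Gamma> (A1 \<^bold>\<and> A2) \<Longrightarrow> derivable R \<Gamma> A2"
| DisjI1: "derivable R \<Gamma> A1 \<Longrightarrow> derivable R \<Gamma> (A1 \<^bold>\<or> A2)"
| DisjI2: "derivable R \<Gamma> A2 \<Longrightarrow> derivable R \<Gamma> (A1 \<^bold>\<or> A2)"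
| DisjE: "derivable R \<Gamma>1 (A1 \<^bold>\<or> A2) \<Longrightarrow> derivable R (\<Gamma>2 \<union> {A1}) B \<Longrightarrow>
    derivable R (\<Gamma>3 \<union> {A2}) B \<Longrightarrow> derivable R (\<Gamma>1 \<union> \<Gamma>2 \<union> \<Gamma>3) B"
| ImpI: "derivable R (\<Gamma> \<union> {A1}) A2 \<Longrightarrow> derivable R \<Gamma> (A1 \<^bold>\<rightarrow> A2)"
| ImpE: "derivable R \<Gamma>1 (A1 \<^bold>\<rightarrow> A2) \<Longrightarrow> derivable R \<Gamma>2 A1 \<Longrightarrow>
    derivable R (\<Gamma>1 \<union> \<Gamma>2) A2"
| BotI: "BotI \<in> R \<Longrightarrow> derivable R \<Gamma> \<^bold>\<bottom> \<Longrightarrow> intuitionistic A \<Longrightarrow> derivable R \<Gamma> A"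
| BotC: "BotC \<in> R \<Longrightarrow> derivable R \<Gamma> (\<^bold>\<not> \<^bold>\<not> A) \<Longrightarrow> classical A \<Longrightarrow> derivable R \<Gamma> A"

text \<open>No finiteness premises are needed: derivable sequents have finite antecedents.\<close>

lemma derivable_finite: "derivable R \<Gamma> A \<Longrightarrow> finite \<Gamma>"
  by (induction rule: derivable.induct) auto

definition proves ::
  "bot_rule set \<Rightarrow> ('m, 'i, 'c) formula set \<Rightarrow> ('m, 'i, 'c) formula \<Rightarrow> bool" where
  "proves R \<Gamma> A \<longleftrightarrow>
    (if finite \<Gamma> then derivable R \<Gamma> A else \<exists>\<Delta>\<subseteq>\<Gamma>. finite \<Delta> \<and> derivable R \<Delta> A)"

lemma derivable_mono:
  assumes "derivable R \<Delta> A" "\<Delta> \<subseteq> \<Gamma>" "finite \<Gamma>"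
  shows "derivable R \<Gamma> A"
proof -
  have "derivable R (\<Delta> \<union> S) A" if "finite S" for S
    using that
  proof (induction S)
    case empty
    then show ?case using assms(1) by simp
  next
    case (insert B S)
    then show ?case using derivable.W[of R "\<Delta> \<union> S" A B] by simp
  qed
  from this[of \<Gamma>] show ?thesis using assms by (simp add: Un_absorb1)
qed

lemma proves_iff: "proves R \<Gamma> A \<longleftrightarrow> (\<exists>\<Delta>\<subseteq>\<Gamma>. finite \<Delta> \<and> derivable R \<Delta> A)"
  unfolding proves_def using derivable_mono by auto

abbreviation pml_proves ::
  "('m, 'i, 'c) formula set \<Rightarrow> ('m, 'i, 'c) formula \<Rightarrow> bool"
  (infix \<open>\<turnstile>\<^sub>p\<^sub>m\<^sub>l\<close> 50) where
  "\<Gamma> \<turnstile>\<^sub>p\<^sub>m\<^sub>l A \<equiv> proves {BotI, BotC} \<Gamma> A"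

abbreviation i_proves ::
  "('m, 'i, 'c) formula set \<Rightarrow> ('m, 'i, 'c) formula \<Rightarrow> bool"
  (infix \<open>\<turnstile>\<^sub>i\<close> 50) where
  "\<Gamma> \<turnstile>\<^sub>i A \<equiv> proves {BotI} \<Gamma> A"

abbreviation m_proves ::
  "('m, 'i, 'c) formula set \<Rightarrow> ('m, 'i, 'c) formula \<Rightarrow> bool"
  (infix \<open>\<turnstile>\<^sub>m\<close> 50) where
  "\<Gamma> \<turnstile>\<^sub>m A \<equiv> proves {} \<Gamma> A"

end

theory Submission
  imports Defs
begin

text \<open>
  Minimal logic already decides every formula built from \<open>\<^bold>\<bottom>\<close> alone: such a formula is
  either provable or interderivable with \<open>\<^bold>\<bottom>\<close>, as one reads off from the truth tables of the
  connectives. Hence both absurdity rules are admissible in minimal logic for variable-free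
  formulas (\<open>closed_ex_falso\<close>, \<open>closed_double_negation\<close>).

  Now take a derivation in the full system and replace every classical variable in it by
  \<open>\<^bold>\<bottom>\<close>. The classical absurdity rule then acts on variable-free formulas only, where
  it is admissible, and every other rule is preserved, since the substitution commutes with the
  connectives and keeps intuitionistic formulas intuitionistic. The end sequent, if it has no
  classical variables, is unchanged. If it has no intuitionistic variables
  either, these can be replaced by \<open>\<^bold>\<bottom>\<close> as well, and then the intuitionistic absurdity
  rule disappears in the same way. Both claims are thus instances of one statement about
  collapsing a set of variables to \<open>\<^bold>\<bottom>\<close> (\<open>derivable_collapse\<close>).
\<close>

lemma derivable_rules_mono:
  assumes "derivable R \<Gamma> A" "R \<subseteq> S"
  shows "derivable S \<Gamma> A"
  using assms(1)
proof (induction rule: derivable.induct)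
  case (BotI \<Gamma> A)
  then show ?case using assms(2) by (blast intro: derivable.BotI)
next
  case (BotC \<Gamma> A)
  then show ?case using assms(2) by (blast intro: derivable.BotC)
qed (blast intro: derivable.intros)+

lemma derivable_cut:
  assumes "derivable R \<Gamma> A" "derivable R {A} B"
  shows "derivable R \<Gamma> B"
proof -
  have "derivable R {} (A \<^bold>\<rightarrow> B)"
    using assms(2) by (intro ImpI) simp
  from ImpE[OF this assms(1)] show ?thesis by simp
qed

text \<open>In the absence of ex falso, refuting \<open>A\<close> does not yield \<open>A \<^bold>\<rightarrow> B\<close>. The first conjunct
  supplies what is missing: if \<open>A\<close> entails \<open>\<^bold>\<bottom>\<close>, then \<open>A \<^bold>\<rightarrow> B\<close> holds because \<open>\<^bold>\<bottom>\<close>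
  entails \<open>B\<close>.\<close>

lemma closed_decided:
  assumes "vars A = {}"
  shows "derivable R {\<^bold>\<bottom>} A \<and> (derivable R {} A \<or> derivable R {A} \<^bold>\<bottom>)"
  using assms
proof (induction A)
  case (Var v)
  then show ?case by simp
next
  case Bot
  show ?case by (simp add: Ax)
next
  case (Conj A B)
  then have A: "derivable R {\<^bold>\<bottom>} A" "derivable R {} A \<or> derivable R {A} \<^bold>\<bottom>"
    and B: "derivable R {\<^bold>\<bottom>} B" "derivable R {} B \<or> derivable R {B} \<^bold>\<bottom>"
    by auto
  have "derivable R {A \<^bold>\<and> B} A" "derivable R {A \<^bold>\<and> B} B"
    by (rule ConjE1[OF Ax], rule ConjE2[OF Ax])
  then show ?case
    using A B ConjI[OF A(1) B(1)] ConjI[of R "{}" A "{}" B]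
    by (auto intro: derivable_cut)
next
  case (Disj A B)
  then have A: "derivable R {\<^bold>\<bottom>} A" "derivable R {} A \<or> derivable R {A} \<^bold>\<bottom>"
    and B: "derivable R {\<^bold>\<bottom>} B" "derivable R {} B \<or> derivable R {B} \<^bold>\<bottom>"
    by auto
  have "derivable R {A \<^bold>\<or> B} \<^bold>\<bottom>" if "derivable R {A} \<^bold>\<bottom>" "derivable R {B} \<^bold>\<bottom>"
    using DisjE[OF Ax, where ?\<Gamma>2.0 = "{}" and ?\<Gamma>3.0 = "{}"] that by simp
  then show ?case
    using A B by (auto intro: DisjI1 DisjI2)
next
  case (Imp A B)
  then have A: "derivable R {} A \<or> derivable R {A} \<^bold>\<bottom>"
    and B: "derivable R {\<^bold>\<bottom>} B" "derivable R {} B \<or> derivable R {B} \<^bold>\<bottom>"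
    by auto
  have "derivable R {\<^bold>\<bottom>} (A \<^bold>\<rightarrow> B)"
    using W[OF B(1)] by (rule ImpI)
  moreover have "derivable R {} (A \<^bold>\<rightarrow> B)" if "derivable R {A} \<^bold>\<bottom>"
    using derivable_cut[OF that B(1)] by (intro ImpI) simp
  moreover have "derivable R {} (A \<^bold>\<rightarrow> B)" if "derivable R {} B"
    using W[OF that] by (rule ImpI)
  moreover have "derivable R {A \<^bold>\<rightarrow> B} \<^bold>\<bottom>" if "derivable R {} A" "derivable R {B} \<^bold>\<bottom>"
    using ImpE[OF Ax that(1)] that(2) by (auto intro: derivable_cut)
  ultimately show ?case using A B(2) by blast
qed

lemma closed_ex_falso:
  assumes "vars A = {}" "derivable R \<Gamma> \<^bold>\<bottom>"
  shows "derivable R \<Gamma> A"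
  using closed_decided[OF assms(1)] assms(2) by (blast intro: derivable_cut)

lemma closed_double_negation:
  assumes "vars A = {}" "derivable R \<Gamma> (\<^bold>\<not> \<^bold>\<not> A)"
  shows "derivable R \<Gamma> A"
proof (cases "derivable R {} A")
  case True
  then show ?thesis
    using derivable_mono derivable_finite[OF assms(2)] by blast
next
  case False
  then have "derivable R ({} \<union> {A}) \<^bold>\<bottom>"
    using closed_decided[OF assms(1)] by auto
  then have "derivable R {} (\<^bold>\<not> A)" by (rule ImpI)
  from ImpE[OF assms(2) this] have "derivable R \<Gamma> \<^bold>\<bottom>" by simp
  with assms(1) show ?thesis by (rule closed_ex_falso)
qed

primrec collapse :: "'v set \<Rightarrow> 'v form \<Rightarrow> 'v form" where
  "collapse X (Var v) = (if v \<in> X then \<^bold>\<bottom> else Var v)"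
| "collapse X \<^bold>\<bottom> = \<^bold>\<bottom>"
| "collapse X (A \<^bold>\<and> B) = collapse X A \<^bold>\<and> collapse X B"
| "collapse X (A \<^bold>\<or> B) = collapse X A \<^bold>\<or> collapse X B"
| "collapse X (A \<^bold>\<rightarrow> B) = collapse X A \<^bold>\<rightarrow> collapse X B"

lemma vars_collapse: "vars (collapse X A) = vars A - X"
  by (induction A) auto

lemma collapse_id: "vars A \<inter> X = {} \<Longrightarrow> collapse X A = A"
  by (induction A) auto

text \<open>An absurdity rule can be dropped once all variables that its formulas may contain are
  collapsed, because it is then applied to closed formulas only. A rule that stays available
  survives the collapse of any variables, as its side condition only bounds the variables of
  the formula from above.\<close>

lemma derivable_collapse:
  assumes "derivable S \<Gamma> A"
    and i: "BotI \<in> R \<or> intuitionistic_vars \<union> classical_vars \<subseteq> X"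
    and c: "BotC \<in> R \<or> classical_vars \<subseteq> X"
  shows "derivable R (collapse X ` \<Gamma>) (collapse X A)"
  using assms(1)
proof (induction rule: derivable.induct)
  case (Ax A)
  show ?case by (simp add: derivable.Ax)
next
  case (W \<Gamma> A B)
  from derivable.W[OF W.IH] show ?case by simp
next
  case (ConjI \<Gamma>1 A1 \<Gamma>2 A2)
  from derivable.ConjI[OF ConjI.IH] show ?case by (simp add: image_Un)
next
  case (ConjE1 \<Gamma> A1 A2)
  then show ?case by (auto intro: derivable.ConjE1)
next
  case (ConjE2 \<Gamma> A1 A2)
  then show ?case by (auto intro: derivable.ConjE2)
next
  case (DisjI1 \<Gamma> A1 A2)
  then show ?case by (auto intro: derivable.DisjI1)
next
  case (DisjI2 \<Gamma> A2 A1)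
  then show ?case by (auto intro: derivable.DisjI2)
next
  case (DisjE \<Gamma>1 A1 A2 \<Gamma>2 B \<Gamma>3)
  then show ?case
    using derivable.DisjE[where ?\<Gamma>2.0 = "collapse X ` \<Gamma>2" and ?\<Gamma>3.0 = "collapse X ` \<Gamma>3"]
    by (simp add: image_Un)
next
  case (ImpI \<Gamma> A1 A2)
  then show ?case by (auto intro: derivable.ImpI)
next
  case (ImpE \<Gamma>1 A1 A2 \<Gamma>2)
  then show ?case
    using derivable.ImpE[of R "collapse X ` \<Gamma>1" "collapse X A1" "collapse X A2"]
    by (simp add: image_Un)
next
  case (BotI \<Gamma> A)
  then have bot: "derivable R (collapse X ` \<Gamma>) \<^bold>\<bottom>" by simp
  from i show ?case
  proof
    assume "BotI \<in> R"
    moreover have "intuitionistic (collapse X A)"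
      using BotI.hyps by (auto simp: intuitionistic_def vars_collapse)
    ultimately show ?thesis using bot by (blast intro: derivable.BotI)
  next
    assume "intuitionistic_vars \<union> classical_vars \<subseteq> X"
    then have "vars (collapse X A) = {}"
      using BotI.hyps unfolding intuitionistic_def vars_collapse by blast
    then show ?thesis using bot by (rule closed_ex_falso)
  qed
next
  case (BotC \<Gamma> A)
  then have notnot: "derivable R (collapse X ` \<Gamma>) (\<^bold>\<not> \<^bold>\<not> collapse X A)" by simp
  from c show ?case
  proof
    assume "BotC \<in> R"
    moreover have "classical (collapse X A)"
      using BotC.hyps by (auto simp: classical_def vars_collapse)
    ultimately show ?thesis using notnot by (blast intro: derivable.BotC)
  next
    assume "classical_vars \<subseteq> X"
    then have "vars (collapse X A) = {}"
      using BotC.hyps unfolding classical_def vars_collapse by blast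
    then show ?thesis using notnot by (rule closed_double_negation)
  qed
qed

lemma proves_conservative:
  assumes "R \<subseteq> S"
    and i: "BotI \<in> R \<or> intuitionistic_vars \<union> classical_vars \<subseteq> X"
    and c: "BotC \<in> R \<or> classical_vars \<subseteq> X"
    and disj: "\<forall>B\<in>\<Gamma> \<union> {A}. vars B \<inter> X = {}"
  shows "proves S \<Gamma> A \<longleftrightarrow> proves R \<Gamma> A"
proof
  assume "proves S \<Gamma> A"
  then obtain \<Delta> where \<Delta>: "\<Delta> \<subseteq> \<Gamma>" "finite \<Delta>" "derivable S \<Delta> A"
    by (auto simp: proves_iff)
  have "collapse X ` \<Delta> = (\<lambda>B. B) ` \<Delta>"
    using disj \<Delta>(1) by (intro image_cong refl collapse_id) blast
  moreover have "collapse X A = A"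
    using disj by (intro collapse_id) blast
  ultimately have "derivable R \<Delta> A"
    using derivable_collapse[OF \<Delta>(3) i c] by simp
  with \<Delta> show "proves R \<Gamma> A" by (auto simp: proves_iff)
next
  assume "proves R \<Gamma> A"
  with \<open>R \<subseteq> S\<close> show "proves S \<Gamma> A"
    by (auto simp: proves_iff intro: derivable_rules_mono)
qed

theorem theorem25:
  fixes \<Gamma> :: "('m::countable, 'i::countable, 'c::countable) formula set"
    and A :: "('m, 'i, 'c) formula"
  shows "((\<forall>B\<in>\<Gamma> \<union> {A}. vars B \<inter> classical_vars = {}) \<longrightarrow>
           (\<Gamma> \<turnstile>\<^sub>p\<^sub>m\<^sub>l A \<longleftrightarrow> \<Gamma> \<turnstile>\<^sub>i A)) \<and>
         ((\<forall>B\<in>\<Gamma> \<union> {A}. vars B \<inter> classical_vars = {} \<and> vars B \<inter> intuitionistic_vars = {}) \<longrightarrow>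
           (\<Gamma> \<turnstile>\<^sub>p\<^sub>m\<^sub>l A \<longleftrightarrow> \<Gamma> \<turnstile>\<^sub>m A))"
proof (intro conjI impI)
  assume "\<forall>B\<in>\<Gamma> \<union> {A}. vars B \<inter> classical_vars = {}"
  then show "\<Gamma> \<turnstile>\<^sub>p\<^sub>m\<^sub>l A \<longleftrightarrow> \<Gamma> \<turnstile>\<^sub>i A"
    by (intro proves_conservative[where X = classical_vars]) simp_all
next
  assume "\<forall>B\<in>\<Gamma> \<union> {A}. vars B \<inter> classical_vars = {} \<and> vars B \<inter> intuitionistic_vars = {}"
  then have "\<forall>B\<in>\<Gamma> \<union> {A}. vars B \<inter> (intuitionistic_vars \<union> classical_vars) = {}"
    by (simp add: Int_Un_distrib)
  then show "\<Gamma> \<turnstile>\<^sub>p\<^sub>m\<^sub>l A \<longleftrightarrow> \<Gamma> \<turnstile>\<^sub>m A"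
    by (intro proves_conservative[where X = "intuitionistic_vars \<union> classical_vars"]) simp_all
qed

end
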